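(* Let $m \geq 2$, let $\mu \in \mathbb{R}\setminus\{0\}$, let $D \subset \mathbb{R}^m$ be a domain, and let $u \in C^2(D)$ be real-valued. (i) If \[ \lim_{r \to +0} \frac{M^\bullet(u,x,r) - u(x)}{r^2} = \frac{\mu^2 u(x)}{2(m+2)} \quad \text{for every } x \in D, \] then $u$ is $\mu$-panharmonic in $D$. (ii) If \[ \lim_{r \to +0} \frac{M^\circ(u,x,r) - u(x)}{r^2} = \frac{\mu^2 u(x)}{2m} \quad \text{for every } x \in D, \] then $u$ is $\mu$-panharmonic in $D$.
   Context: A domain is a connected open set. A real-valued function $u \in C^2(D)$ is called $\mu$-panharmonic in $D$ if $\nabla^2 u - \mu^2 u = 0$ in $D$. $B_r(x)$ is the open ball of radius $r$ centred at $x$ and $S_r(x)=\partial B_r(x)$. For $\overline{B_r(x)} \subset D$, $M^\bullet(u,x,r) = |B_r|^{-1}\int_{B_r(x)} u(y)\,dy$ is the volume mean and $M^\circ(u,x,r) = |S_r|^{-1}\int_{S_r(x)} u(y)\,dS_y$ is the spherical mean, where $|B_r|$ and $|S_r|$ are the volume of the ball and the area of the sphere of radius $r$. *)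

theory Defs
  imports "HOL-Analysis.Analysis"
begin

definition domain :: "'a::topological_space set \<Rightarrow> bool" where
  "domain D \<longleftrightarrow> open D \<and> connected D"

definition C2_on :: "('a::euclidean_space \<Rightarrow> real) \<Rightarrow> 'a set \<Rightarrow> bool" where
  "C2_on u D \<longleftrightarrow>
     (\<exists>(u' :: 'a \<Rightarrow> 'a \<Rightarrow>\<^sub>L real) (u'' :: 'a \<Rightarrow> 'a \<Rightarrow>\<^sub>L ('a \<Rightarrow>\<^sub>L real)).
        (\<forall>x\<in>D. (u has_derivative blinfun_apply (u' x)) (at x)) \<and>
        (\<forall>x\<in>D. (u' has_derivative blinfun_apply (u'' x)) (at x)) \<and>
        continuous_on D u'')"

definition partial_deriv :: "'a::euclidean_space \<Rightarrow> ('a \<Rightarrow> real) \<Rightarrow> 'a \<Rightarrow> real" where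
  "partial_deriv b u x = deriv (\<lambda>t. u (x + t *\<^sub>R b)) 0"

definition laplacian :: "('a::euclidean_space \<Rightarrow> real) \<Rightarrow> 'a \<Rightarrow> real" where
  "laplacian u x = (\<Sum>b\<in>Basis. partial_deriv b (partial_deriv b u) x)"

definition panharmonic_on :: "real \<Rightarrow> ('a::euclidean_space \<Rightarrow> real) \<Rightarrow> 'a set \<Rightarrow> bool" where
  "panharmonic_on \<mu> u D \<longleftrightarrow> C2_on u D \<and> (\<forall>x\<in>D. laplacian u x - \<mu>\<^sup>2 * u x = 0)"

definition ball_mean :: "('a::euclidean_space \<Rightarrow> real) \<Rightarrow> 'a \<Rightarrow> real \<Rightarrow> real" where
  "ball_mean u x r = (LINT y:ball x r|lborel. u y) / measure lborel (ball x r)"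

text \<open>
  The (unnormalised) surface area measure on the sphere of radius \<open>r\<close> about \<open>c\<close>, as a Borel
  measure on the whole space concentrated on that sphere. It is the classical construction from
  Lebesgue measure: the area of a Borel subset \<open>A\<close> of the sphere is \<open>m / r\<close> times
  the volume of the cone with apex \<open>c\<close> over \<open>A\<close>, where \<open>m\<close> is the dimension. Below, the cone is
  written as the preimage of \<open>A\<close> under the radial projection of the punctured ball onto the sphere;
  lemma \<open>emeasure_sphere_measure\<close> gives the description by cones and \<open>measure_sphere\<close>
  the total area.
\<close>

definition sphere_measure :: "'a::euclidean_space \<Rightarrow> real \<Rightarrow> 'a measure" where
  "sphere_measure c r =
     scale_measure (ennreal (real DIM('a) / r))
       (distr (restrict_space lborel (cball c r - {c})) borel
          (\<lambda>z. c + (r / dist c z) *\<^sub>R (z - c)))"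

lemma emeasure_sphere_measure:
  fixes c :: "'a::euclidean_space"
  assumes r: "r > 0" and A: "A \<in> sets borel" "A \<subseteq> sphere c r"
  shows "emeasure (sphere_measure c r) A =
    ennreal (real DIM('a) / r) *
      emeasure lborel {c + t *\<^sub>R (y - c) | t y. 0 < t \<and> t \<le> 1 \<and> y \<in> A}"
proof -
  let ?R = "restrict_space lborel (cball c r - {c})"
  let ?p = "\<lambda>z. c + (r / dist c z) *\<^sub>R (z - c)"
  have p: "?p \<in> measurable ?R borel"
    by (intro measurable_restrict_space1) measurable
  have "?p -` A \<inter> (cball c r - {c}) = {c + t *\<^sub>R (y - c) | t y. 0 < t \<and> t \<le> 1 \<and> y \<in> A}"
  proof (intro equalityI subsetI)
    fix z assume z: "z \<in> ?p -` A \<inter> (cball c r - {c})"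
    then have "z = c + (dist c z / r) *\<^sub>R (?p z - c)" "0 < dist c z / r" "dist c z / r \<le> 1" "?p z \<in> A"
      using r by auto
    then show "z \<in> {c + t *\<^sub>R (y - c) | t y. 0 < t \<and> t \<le> 1 \<and> y \<in> A}" by blast
  next
    fix z assume "z \<in> {c + t *\<^sub>R (y - c) | t y. 0 < t \<and> t \<le> 1 \<and> y \<in> A}"
    then obtain t y where ty: "z = c + t *\<^sub>R (y - c)" "0 < t" "t \<le> 1" "y \<in> A" by blast
    have y: "dist c y = r" using A ty by auto
    then have d: "dist c z = t * r" and "y \<noteq> c"
      using ty r by (auto simp: dist_norm norm_minus_commute)
    moreover have "t * r \<le> r" using ty r by (simp add: mult_left_le_one_le)
    moreover have "?p z = y" using d ty r by simp
    ultimately show "z \<in> ?p -` A \<inter> (cball c r - {c})" using ty r by auto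
  qed
  moreover have "emeasure ?R (?p -` A \<inter> (cball c r - {c})) =
      emeasure lborel (?p -` A \<inter> (cball c r - {c}))"
    by (rule emeasure_restrict_space) auto
  ultimately show ?thesis
    using A p by (simp add: sphere_measure_def emeasure_distr space_restrict_space)
qed

lemma measure_sphere:
  fixes c :: "'a::euclidean_space"
  assumes r: "r > 0"
  shows "measure (sphere_measure c r) (sphere c r) =
    real DIM('a) * unit_ball_vol (real DIM('a)) * r ^ (DIM('a) - 1)"
proof -
  let ?R = "restrict_space lborel (cball c r - {c})"
  let ?p = "\<lambda>z. c + (r / dist c z) *\<^sub>R (z - c)"
  have p: "?p \<in> measurable ?R borel"
    by (intro measurable_restrict_space1) measurable
  have s: "?p -` sphere c r \<inter> (cball c r - {c}) = cball c r - {c}"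
    using r by (auto simp: dist_norm norm_minus_commute)
  have "emeasure (sphere_measure c r) (sphere c r) =
      ennreal (real DIM('a) / r) * emeasure lborel (cball c r - {c})"
    using p s by (simp add: sphere_measure_def emeasure_distr emeasure_restrict_space
        space_restrict_space)
  also have "emeasure lborel (cball c r - {c}) = emeasure lborel (cball c r)"
    by (rule emeasure_Diff_null_set) (auto simp: null_sets_def)
  also have "\<dots> = ennreal (unit_ball_vol (real DIM('a)) * r ^ DIM('a))"
    using r by (simp add: emeasure_cball)
  also have "ennreal (real DIM('a) / r) * \<dots> =
      ennreal (real DIM('a) / r * (unit_ball_vol (real DIM('a)) * r ^ DIM('a)))"
    using r by (intro ennreal_mult[symmetric]) auto
  also have "real DIM('a) / r * (unit_ball_vol (real DIM('a)) * r ^ DIM('a)) =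
      real DIM('a) * unit_ball_vol (real DIM('a)) * r ^ (DIM('a) - 1)"
    using r by (cases "DIM('a)") (simp_all add: field_simps)
  finally show ?thesis using r by (simp add: measure_def)
qed

definition sphere_mean :: "('a::euclidean_space \<Rightarrow> real) \<Rightarrow> 'a \<Rightarrow> real \<Rightarrow> real" where
  "sphere_mean u x r =
     (LINT y:sphere x r|sphere_measure x r. u y) / measure (sphere_measure x r) (sphere x r)"

end

theory Submission
  imports Defs "HOL-Probability.Probability_Measure"
begin

text \<open>
  Both implications follow from the second-order expansion of the two means. For \<open>u\<close> of class
  \<open>C\<^sup>2\<close> on an open set of an \<open>m\<close>-dimensional space and \<open>x\<close> in that set, as \<open>r \<rightarrow> 0+\<close>,
  the volume mean is \<open>u x + r\<^sup>2 \<Delta>u(x) / (2 (m + 2)) + o(r\<^sup>2)\<close> and the spherical mean is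
  \<open>u x + r\<^sup>2 \<Delta>u(x) / (2 m) + o(r\<^sup>2)\<close> (lemma \<open>mean_value_tendsto_laplacian\<close>). Each hypothesis
  prescribes the limit of the corresponding difference quotient, and uniqueness of limits turns it
  into \<open>\<Delta>u(x) = \<mu>\<^sup>2 u(x)\<close>.

  The two expansions have a common source. With \<open>z\<close> uniformly distributed in the unit ball, the
  volume mean is the expectation of \<open>u (x + r z)\<close>, and the spherical mean is that of
  \<open>u (x + r z / |z|)\<close>, because surface measure is built from volumes of cones. In both cases the
  argument of \<open>u\<close> is \<open>x + r \<phi>\<close> with a bounded random vector \<open>\<phi>\<close>. Taylor's formula
  (\<open>second_order_taylor\<close>) gives
  \<open>E u(x + r \<phi>) = u x + r E(u'(x) \<phi>) + r\<^sup>2/2 E(u''(x) \<phi> \<phi>) + o(r\<^sup>2)\<close>, so only the first and second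
  moments of \<open>\<phi>\<close> matter (\<open>expectation_random_displacement\<close>). The law of \<open>\<phi>\<close> is invariant under
  reflecting a coordinate and under exchanging two of them, so the mean is zero and the covariance
  matrix is \<open>E|\<phi>|\<^sup>2 / m\<close> times the identity (\<open>radial_moments_uniform_unit_ball\<close>): the Hessian
  contributes its trace. Finally \<open>E|\<phi>|\<^sup>2\<close> equals \<open>1\<close> for the sphere and \<open>m / (m + 2)\<close> for the ball
  (\<open>second_moment_uniform_unit_ball\<close>).
\<close>

section \<open>Second-order expansions\<close>

text \<open>
  Along the segment from \<open>x\<close> to \<open>x + h\<close> the remainder has derivative
  \<open>(u'(x + t h) - u'(x) - t u''(x) h) h\<close>, which differentiability of \<open>u'\<close> at the single point \<open>x\<close>
  bounds by \<open>e |h|\<^sup>2\<close>.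
\<close>
lemma second_order_taylor:
  fixes u :: "'a::real_normed_vector \<Rightarrow> real"
    and u' :: "'a \<Rightarrow> 'a \<Rightarrow>\<^sub>L real" and u2 :: "'a \<Rightarrow>\<^sub>L ('a \<Rightarrow>\<^sub>L real)"
  assumes D: "open D" "x \<in> D"
    and u': "\<And>y. y \<in> D \<Longrightarrow> (u has_derivative blinfun_apply (u' y)) (at y)"
    and u2: "(u' has_derivative blinfun_apply u2) (at x)"
    and e: "e > 0"
  obtains d where "d > 0"
    and "\<And>h. norm h < d \<Longrightarrow> \<bar>u (x + h) - u x - u' x h - u2 h h / 2\<bar> \<le> e * (norm h)\<^sup>2"
proof -
  obtain d1 where d1: "d1 > 0" "ball x d1 \<subseteq> D" using D open_contains_ball by blast
  obtain d2 where d2: "d2 > 0"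
    "\<And>y. norm (y - x) < d2 \<Longrightarrow> norm (u' y - u' x - u2 (y - x)) \<le> e * norm (y - x)"
    using u2 e unfolding has_derivative_at_alt by blast
  show thesis
  proof (rule that[of "min d1 d2"])
    show "min d1 d2 > 0" using d1 d2 by simp
    fix h :: 'a assume h: "norm h < min d1 d2"
    define g where "g t = u (x + t *\<^sub>R h) - t * u' x h - t\<^sup>2 / 2 * u2 h h" for t :: real
    define g' where "g' t = u' (x + t *\<^sub>R h) h - u' x h - t * u2 h h" for t :: real
    have th: "norm (t *\<^sub>R h) \<le> norm h" if "0 \<le> t" "t \<le> 1" for t :: real
      using that by (simp add: mult_left_le_one_le)
    have "(g has_real_derivative g' t) (at t)" if "0 \<le> t" "t \<le> 1" for t
    proof -
      have "x + t *\<^sub>R h \<in> D" using th[OF that] h d1 by (auto simp: dist_norm)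
      then have "((\<lambda>t. u (x + t *\<^sub>R h)) has_derivative (\<lambda>s. u' (x + t *\<^sub>R h) (s *\<^sub>R h))) (at t)"
        by (intro has_derivative_compose[of "\<lambda>t. x + t *\<^sub>R h" "\<lambda>s. s *\<^sub>R h" t UNIV u] u')
          (auto intro!: derivative_eq_intros)
      then have "((\<lambda>t. u (x + t *\<^sub>R h)) has_real_derivative u' (x + t *\<^sub>R h) h) (at t)"
        unfolding has_field_derivative_def by (rule has_derivative_eq_rhs) (auto simp: blinfun.scaleR_right)
      then show ?thesis unfolding g_def g'_def
        by (auto intro!: derivative_eq_intros)
    qed
    from MVT2[of 0 1 g g', OF _ this]
    obtain t where t: "0 < t" "t < 1" "g 1 - g 0 = g' t" by auto
    have "\<bar>g' t\<bar> = \<bar>(u' (x + t *\<^sub>R h) - u' x - u2 (x + t *\<^sub>R h - x)) h\<bar>"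
      by (simp add: g'_def blinfun.diff_left blinfun.scaleR_right blinfun.scaleR_left)
    also have "\<dots> \<le> norm (u' (x + t *\<^sub>R h) - u' x - u2 (x + t *\<^sub>R h - x)) * norm h"
      using norm_blinfun[of "u' (x + t *\<^sub>R h) - u' x - u2 (x + t *\<^sub>R h - x)" h] by simp
    also have "\<dots> \<le> (e * norm (x + t *\<^sub>R h - x)) * norm h"
      using th[of t] t h by (intro mult_right_mono d2) auto
    also have "\<dots> \<le> (e * norm h) * norm h"
      using th[of t] t e by (intro mult_right_mono mult_left_mono) auto
    finally show "\<bar>u (x + h) - u x - u' x h - u2 h h / 2\<bar> \<le> e * (norm h)\<^sup>2"
      using t(3) by (simp add: g_def power2_eq_square mult.assoc)
  qed
qed

text \<open>
  The linear Taylor term averages to zero and the quadratic one to \<open>c/2\<close> times the trace of the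
  Hessian. Taylor's remainder is at most \<open>e r\<^sup>2\<close> uniformly in the sample point, since the
  displacement is bounded.
\<close>
lemma (in prob_space) expectation_random_displacement:
  fixes u :: "'b::euclidean_space \<Rightarrow> real" and \<phi> :: "'a \<Rightarrow> 'b"
    and u' :: "'b \<Rightarrow> 'b \<Rightarrow>\<^sub>L real" and u2 :: "'b \<Rightarrow>\<^sub>L ('b \<Rightarrow>\<^sub>L real)"
  assumes [measurable]: "u \<in> borel_measurable borel" "\<phi> \<in> borel_measurable M"
    and bound: "AE \<omega> in M. norm (\<phi> \<omega>) \<le> 1"
    and mean: "\<And>b. b \<in> Basis \<Longrightarrow> expectation (\<lambda>\<omega>. \<phi> \<omega> \<bullet> b) = 0"
    and cov: "\<And>b d. b \<in> Basis \<Longrightarrow> d \<in> Basis \<Longrightarrow>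
      expectation (\<lambda>\<omega>. (\<phi> \<omega> \<bullet> b) * (\<phi> \<omega> \<bullet> d)) = (if b = d then c else 0)"
    and D: "open D" "x \<in> D"
    and u': "\<And>y. y \<in> D \<Longrightarrow> (u has_derivative blinfun_apply (u' y)) (at y)"
    and u2: "(u' has_derivative blinfun_apply u2) (at x)"
  shows "((\<lambda>r. (expectation (\<lambda>\<omega>. u (x + r *\<^sub>R \<phi> \<omega>)) - u x) / r\<^sup>2)
    \<longlongrightarrow> c / 2 * (\<Sum>b\<in>Basis. u2 b b)) (at_right 0)"
proof -
  \<comment> \<open>The Taylor terms in coordinates, where measurability and the moments can be read off. The
    order of \<open>b\<close> and \<open>d\<close> in \<open>u2 d b\<close> is the one that expanding \<open>u2 h h\<close> produces.\<close>
  define L where "L h = (\<Sum>b\<in>Basis. (h \<bullet> b) * u' x b)" for h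
  define Q where "Q h = (\<Sum>b\<in>Basis. \<Sum>d\<in>Basis. ((h \<bullet> b) * (h \<bullet> d)) * u2 d b)" for h
  have L: "u' x h = L h" for h
    by (subst (1) euclidean_representation[symmetric, of h])
      (simp add: L_def blinfun.sum_right blinfun.scaleR_right)
  have Q: "u2 h h = Q h" for h
    by (subst (1 2) euclidean_representation[symmetric, of h])
      (simp add: Q_def blinfun.sum_right blinfun.scaleR_right blinfun.sum_left blinfun.scaleR_left
        sum_distrib_left mult.assoc)
  have comp: "AE \<omega> in M. \<bar>\<phi> \<omega> \<bullet> b\<bar> \<le> 1" if "b \<in> Basis" for b
    using bound by eventually_elim (meson Basis_le_norm that order_trans)
  have i1: "integrable M (\<lambda>\<omega>. \<phi> \<omega> \<bullet> b)" if "b \<in> Basis" for b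
    using comp[OF that] by (intro integrable_const_bound[where B = 1]) auto
  have i2: "integrable M (\<lambda>\<omega>. (\<phi> \<omega> \<bullet> b) * (\<phi> \<omega> \<bullet> d))" if "b \<in> Basis" "d \<in> Basis" for b d
  proof (rule integrable_const_bound[where B = 1])
    show "AE \<omega> in M. norm ((\<phi> \<omega> \<bullet> b) * (\<phi> \<omega> \<bullet> d)) \<le> 1"
      using comp[OF that(1)] comp[OF that(2)]
      by eventually_elim (auto simp: abs_mult intro!: mult_le_one)
  qed measurable
  have iL: "integrable M (\<lambda>\<omega>. L (\<phi> \<omega>))" and EL: "expectation (\<lambda>\<omega>. L (\<phi> \<omega>)) = 0"
    unfolding L_def using i1 mean by simp_all
  have iQ: "integrable M (\<lambda>\<omega>. Q (\<phi> \<omega>))"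
    unfolding Q_def using i2 by simp
  have EQ: "expectation (\<lambda>\<omega>. Q (\<phi> \<omega>)) = c * (\<Sum>b\<in>Basis. u2 b b)"
    unfolding Q_def using i2
    by (simp add: cov if_distrib[where f = "\<lambda>s. s * _"] sum_distrib_left cong: if_cong)
  show ?thesis
  proof (rule tendstoI)
    fix e :: real assume e: "e > 0"
    then have "e / 2 > 0" by simp
    from second_order_taylor[OF D u' u2 this]
    obtain d where d: "d > 0"
      "\<And>h. norm h < d \<Longrightarrow> \<bar>u (x + h) - u x - u' x h - u2 h h / 2\<bar> \<le> e / 2 * (norm h)\<^sup>2" by blast
    have "dist ((expectation (\<lambda>\<omega>. u (x + r *\<^sub>R \<phi> \<omega>)) - u x) / r\<^sup>2) (c / 2 * (\<Sum>b\<in>Basis. u2 b b)) < e"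
      if r: "0 < r" "r < d" for r
    proof -
      define R where "R \<omega> = u (x + r *\<^sub>R \<phi> \<omega>) - (u x + r * L (\<phi> \<omega>) + r\<^sup>2 / 2 * Q (\<phi> \<omega>))" for \<omega>
      have Rb: "AE \<omega> in M. \<bar>R \<omega>\<bar> \<le> e / 2 * r\<^sup>2"
        using bound
      proof eventually_elim
        case (elim \<omega>)
        then have n: "norm (r *\<^sub>R \<phi> \<omega>) \<le> r" using r by (simp add: mult_left_le)
        then have "norm (r *\<^sub>R \<phi> \<omega>) < d" using r by linarith
        then have "\<bar>R \<omega>\<bar> \<le> e / 2 * (norm (r *\<^sub>R \<phi> \<omega>))\<^sup>2"
          using d(2)[of "r *\<^sub>R \<phi> \<omega>"] unfolding R_def
          by (simp add: L[symmetric] Q[symmetric] blinfun.scaleR_right blinfun.scaleR_left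
              power2_eq_square algebra_simps)
        also have "\<dots> \<le> e / 2 * r\<^sup>2"
          using n e by (intro mult_left_mono power_mono) auto
        finally show ?case .
      qed
      have [measurable]: "R \<in> borel_measurable M"
        unfolding R_def L_def Q_def by measurable
      have iR: "integrable M R"
        using Rb by (intro integrable_const_bound[where B = "e / 2 * r\<^sup>2"]) auto
      have "expectation (\<lambda>\<omega>. u (x + r *\<^sub>R \<phi> \<omega>)) =
          expectation (\<lambda>\<omega>. R \<omega> + (u x + r * L (\<phi> \<omega>) + r\<^sup>2 / 2 * Q (\<phi> \<omega>)))"
        by (simp add: R_def)
      also have "\<dots> = expectation R + (u x + r\<^sup>2 / 2 * (c * (\<Sum>b\<in>Basis. u2 b b)))"
        using iR iL iQ by (simp add: EL EQ prob_space)
      finally have "(expectation (\<lambda>\<omega>. u (x + r *\<^sub>R \<phi> \<omega>)) - u x) / r\<^sup>2 - c / 2 * (\<Sum>b\<in>Basis. u2 b b)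
          = expectation R / r\<^sup>2"
        using r by (simp add: field_simps)
      moreover have "\<bar>expectation R\<bar> \<le> e / 2 * r\<^sup>2"
      proof -
        have "\<bar>expectation R\<bar> \<le> expectation (\<lambda>\<omega>. \<bar>R \<omega>\<bar>)" by (rule integral_abs_bound)
        also have "\<dots> \<le> expectation (\<lambda>\<omega>. e / 2 * r\<^sup>2)"
          using iR Rb by (intro integral_mono_AE) auto
        finally show ?thesis by (simp add: prob_space)
      qed
      then have "\<bar>expectation R / r\<^sup>2\<bar> \<le> e / 2" using r by (simp add: field_simps)
      ultimately show ?thesis using e unfolding dist_real_def by linarith
    qed
    then show "\<forall>\<^sub>F r in at_right 0.
        dist ((expectation (\<lambda>\<omega>. u (x + r *\<^sub>R \<phi> \<omega>)) - u x) / r\<^sup>2) (c / 2 * (\<Sum>b\<in>Basis. u2 b b)) < e"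
      using d(1) unfolding eventually_at_right_field by blast
  qed
qed

lemma laplacian_eq_trace:
  fixes u :: "'a::euclidean_space \<Rightarrow> real"
    and u' :: "'a \<Rightarrow> 'a \<Rightarrow>\<^sub>L real" and u2 :: "'a \<Rightarrow>\<^sub>L ('a \<Rightarrow>\<^sub>L real)"
  assumes D: "open D" "x \<in> D"
    and u': "\<And>y. y \<in> D \<Longrightarrow> (u has_derivative blinfun_apply (u' y)) (at y)"
    and u2: "(u' has_derivative blinfun_apply u2) (at x)"
  shows "laplacian u x = (\<Sum>b\<in>Basis. u2 b b)"
proof -
  have line: "partial_deriv b f y = f' b"
    if "(f has_derivative f') (at y)" for f :: "'a \<Rightarrow> real" and f' b y
  proof -
    have 1: "((\<lambda>t. f (y + t *\<^sub>R b)) has_derivative (\<lambda>s. f' (s *\<^sub>R b))) (at 0)"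
      using that by (intro has_derivative_compose[of "\<lambda>t. y + t *\<^sub>R b" "\<lambda>s. s *\<^sub>R b" 0 UNIV f f'])
        (auto intro!: derivative_eq_intros)
    have "linear f'" using that has_derivative_linear by blast
    then have "((\<lambda>t. f (y + t *\<^sub>R b)) has_real_derivative f' b) (at 0)"
      unfolding has_field_derivative_def
      by (intro has_derivative_eq_rhs[OF 1]) (auto simp: linear_cmul)
    then show ?thesis unfolding partial_deriv_def by (rule DERIV_imp_deriv)
  qed
  have "partial_deriv b (partial_deriv b u) x = u2 b b" for b
  proof (rule line[where f' = "\<lambda>h. u2 h b"])
    have "((\<lambda>y. u' y b) has_derivative (\<lambda>h. u2 h b)) (at x)"
      using u2 by (auto intro!: derivative_eq_intros)
    then show "(partial_deriv b u has_derivative (\<lambda>h. u2 h b)) (at x)"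
      by (rule has_derivative_transform_within_open[OF _ D]) (simp add: line[OF u'])
  qed
  then show ?thesis by (simp add: laplacian_def)
qed
section \<open>Symmetries of Lebesgue measure and of the unit ball\<close>

lemma balls_and_spheres_borel [measurable]:
  "ball (c::'a::euclidean_space) r \<in> sets borel" "cball c r \<in> sets borel" "sphere c r \<in> sets borel"
  by (auto intro: borel_open borel_closed)

lemma lborel_integral_affine:
  fixes f :: "'a::euclidean_space \<Rightarrow> real"
  assumes [measurable]: "f \<in> borel_measurable borel" and c: "c \<noteq> 0"
  shows "(\<integral>z. f z \<partial>lborel) = \<bar>c\<bar> ^ DIM('a) * (\<integral>z. f (t + c *\<^sub>R z) \<partial>lborel)"
  by (subst lborel_affine[OF c, of t]) (simp add: integral_density integral_distr)

lemma distr_lborel_reflect_coordinate: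
  "distr lborel borel (\<lambda>z::'a::euclidean_space. \<Sum>b\<in>Basis. ((if b = i then -1 else 1) * (z \<bullet> b)) *\<^sub>R b) = lborel"
proof -
  have "(\<Prod>b\<in>(Basis::'a set). ennreal \<bar>if b = i then - 1 else 1\<bar>) = 1"
    by (intro prod.neutral) auto
  with lborel_affine_euclidean[of "\<lambda>b::'a. if b = i then - 1 else 1" 0] show ?thesis
    by (simp add: density_1 prod_ennreal)
qed

lemma distr_lborel_permute_coordinates:
  fixes \<tau> :: "'a::euclidean_space \<Rightarrow> 'a"
  assumes \<tau>: "bij_betw \<tau> Basis Basis"
  shows "distr lborel borel (\<lambda>z::'a. \<Sum>b\<in>Basis. (z \<bullet> \<tau> b) *\<^sub>R b) = lborel"
proof (rule lborel_eqI[symmetric])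
  let ?T = "\<lambda>z::'a. \<Sum>b\<in>Basis. (z \<bullet> \<tau> b) *\<^sub>R b"
  define \<sigma> where "\<sigma> = inv_into Basis \<tau>"
  have \<sigma>: "\<sigma> b \<in> Basis" "\<tau> (\<sigma> b) = b" if "b \<in> Basis" for b
    using \<tau> that by (auto simp: \<sigma>_def bij_betw_def inv_into_into f_inv_into_f)
  have \<sigma>\<tau>: "\<sigma> (\<tau> b) = b" "\<tau> b \<in> Basis" if "b \<in> Basis" for b
    using \<tau> that by (auto simp: \<sigma>_def bij_betw_def inv_into_f_f)
  have bij\<sigma>: "bij_betw \<sigma> Basis Basis"
    unfolding \<sigma>_def by (rule bij_betw_inv_into[OF \<tau>])
  fix l u :: 'a assume le: "\<And>b. b \<in> Basis \<Longrightarrow> l \<bullet> b \<le> u \<bullet> b"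
  let ?S = "\<lambda>z::'a. \<Sum>b\<in>Basis. (z \<bullet> \<sigma> b) *\<^sub>R b"
  have "?T -` box l u = box (?S l) (?S u)"
  proof -
    have "(\<forall>b\<in>Basis. l \<bullet> b < z \<bullet> \<tau> b \<and> z \<bullet> \<tau> b < u \<bullet> b) \<longleftrightarrow>
        (\<forall>b\<in>Basis. l \<bullet> \<sigma> b < z \<bullet> b \<and> z \<bullet> b < u \<bullet> \<sigma> b)" for z
      using \<sigma> \<sigma>\<tau> by metis
    then show ?thesis by (auto simp: box_def)
  qed
  then have "emeasure (distr lborel borel ?T) (box l u) = emeasure lborel (box (?S l) (?S u))"
    by (simp add: emeasure_distr)
  also have "\<dots> = (\<Prod>b\<in>Basis. (u - l) \<bullet> \<sigma> b)"
    using le \<sigma> by (subst emeasure_lborel_box) (auto simp: inner_diff_left intro!: prod.cong)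
  also have "\<dots> = (\<Prod>b\<in>Basis. (u - l) \<bullet> b)"
    using prod.reindex_bij_betw[OF bij\<sigma>, of "\<lambda>b. (u - l) \<bullet> b"] by simp
  finally show "emeasure (distr lborel borel ?T) (box l u) = (\<Prod>b\<in>Basis. (u - l) \<bullet> b)" .
qed simp

abbreviation uniform_unit_ball :: "'a::euclidean_space measure" where
  "uniform_unit_ball \<equiv> uniform_measure lborel (ball 0 1)"

lemma measure_unit_ball_pos: "measure lborel (ball (0::'a::euclidean_space) 1) > 0"
  by (simp add: content_ball_pos)

lemma emeasure_unit_ball:
  "emeasure lborel (ball (0::'a::euclidean_space) 1) = ennreal (measure lborel (ball (0::'a) 1))"
  using emeasure_lborel_ball_finite[of "0::'a" 1] by (intro emeasure_eq_ennreal_measure) auto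

lemma prob_space_uniform_unit_ball: "prob_space (uniform_unit_ball :: 'a::euclidean_space measure)"
proof (rule prob_space_uniform_measure)
  show "emeasure lborel (ball (0::'a) 1) \<noteq> 0"
    using measure_unit_ball_pos[where 'a='a] by (simp add: emeasure_unit_ball)
  show "emeasure lborel (ball (0::'a) 1) \<noteq> \<infinity>" by (simp add: emeasure_unit_ball)
qed

lemma integral_uniform_unit_ball:
  fixes f :: "'a::euclidean_space \<Rightarrow> real"
  assumes [measurable]: "f \<in> borel_measurable borel"
  shows "(\<integral>z. f z \<partial>uniform_unit_ball) =
    (\<integral>z. indicator (ball 0 1) z * f z \<partial>lborel) / measure lborel (ball (0::'a) 1)"
proof -
  have eq: "(\<lambda>z::'a. indicator (ball 0 1) z / emeasure lborel (ball (0::'a) 1)) =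
      (\<lambda>z. ennreal (indicator (ball 0 1) z / measure lborel (ball (0::'a) 1)))"
    (is "?l = ?r")
  proof
    fix z :: 'a
    have "?r z = ennreal (indicator (ball 0 1) z) / ennreal (measure lborel (ball (0::'a) 1))"
      by (rule divide_ennreal[symmetric]) (auto simp: measure_unit_ball_pos)
    then show "?l z = ?r z" by (simp add: emeasure_unit_ball ennreal_indicator)
  qed
  show ?thesis
    unfolding uniform_measure_def eq
    by (subst integral_density) auto
qed

lemma integral_uniform_unit_ball_invariant:
  fixes f :: "'a::euclidean_space \<Rightarrow> real" and T :: "'a \<Rightarrow> 'a"
  assumes [measurable]: "f \<in> borel_measurable borel" "T \<in> borel_measurable borel"
    and T: "distr lborel borel T = lborel" "\<And>z. norm (T z) = norm z"
  shows "(\<integral>z. f (T z) \<partial>uniform_unit_ball) = (\<integral>z. f z \<partial>uniform_unit_ball)"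
proof -
  have "(\<integral>z. indicator (ball 0 1) z * f z \<partial>lborel) = (\<integral>z. indicator (ball 0 1) z * f z \<partial>distr lborel borel T)"
    by (simp add: T)
  also have "\<dots> = (\<integral>z. indicator (ball 0 1) (T z) * f (T z) \<partial>lborel)"
    by (rule integral_distr) measurable
  also have "\<dots> = (\<integral>z. indicator (ball 0 1) z * f (T z) \<partial>lborel)"
    by (intro Bochner_Integration.integral_cong) (auto simp: T indicator_def)
  finally show ?thesis by (simp add: integral_uniform_unit_ball)
qed

text \<open>
  The factor \<open>w (norm z)\<close> does not see a coordinate reflection or exchange, so \<open>\<phi>\<close> commutes with
  these maps. Reflecting the coordinate \<open>a\<close> changes the sign of \<open>\<phi> z \<bullet> a\<close> and, for \<open>b \<noteq> a\<close>, of the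
  mixed product; hence both integrals equal their negatives. Exchanging coordinates shows that all
  components have the same second moment, and these add up to that of \<open>norm (\<phi> z)\<close>.
\<close>
lemma radial_moments_uniform_unit_ball:
  fixes \<phi> :: "'a::euclidean_space \<Rightarrow> 'a"
  assumes \<phi>: "\<And>z. \<phi> z = w (norm z) *\<^sub>R z"
    and [measurable]: "\<phi> \<in> borel_measurable borel"
    and bound: "AE z in uniform_unit_ball. norm (\<phi> z) \<le> 1"
    and a: "a \<in> Basis" and b: "b \<in> Basis"
  shows "(\<integral>z. \<phi> z \<bullet> a \<partial>uniform_unit_ball) = 0"
    and "(\<integral>z. (\<phi> z \<bullet> a) * (\<phi> z \<bullet> b) \<partial>uniform_unit_ball) =
      (if a = b then (\<integral>z. (norm (\<phi> z))\<^sup>2 \<partial>uniform_unit_ball) / DIM('a) else 0)"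
proof -
  interpret prob_space "uniform_unit_ball :: 'a measure" by (rule prob_space_uniform_unit_ball)
  have reflect: "(\<integral>z. \<phi> z \<bullet> a \<partial>uniform_unit_ball) = 0 \<and>
    (a \<noteq> b \<longrightarrow> (\<integral>z. (\<phi> z \<bullet> a) * (\<phi> z \<bullet> b) \<partial>uniform_unit_ball) = 0)"
  proof -
    define T where "T z = (\<Sum>d\<in>Basis. ((if d = a then -1 else 1) * (z \<bullet> d)) *\<^sub>R d)" for z :: 'a
    have [measurable]: "T \<in> borel_measurable borel" unfolding T_def by measurable
    have Tl: "distr lborel borel T = lborel"
      using distr_lborel_reflect_coordinate[of a] unfolding T_def[abs_def] .
    have Tc: "T z \<bullet> d = (if d = a then - (z \<bullet> d) else z \<bullet> d)" if "d \<in> Basis" for z d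
      using that by (simp add: T_def)
    have Tn: "norm (T z) = norm z" for z
      unfolding norm_eq euclidean_inner[of "T z" "T z"] euclidean_inner[of z z]
      by (intro sum.cong) (auto simp: Tc)
    have "(\<integral>z. \<phi> z \<bullet> a \<partial>uniform_unit_ball) = (\<integral>z. \<phi> (T z) \<bullet> a \<partial>uniform_unit_ball)"
      by (rule integral_uniform_unit_ball_invariant[OF _ _ Tl Tn, symmetric]) measurable
    also have "\<dots> = (\<integral>z. - (\<phi> z \<bullet> a) \<partial>uniform_unit_ball)"
      using a by (simp add: \<phi> Tn Tc)
    finally have 1: "(\<integral>z. \<phi> z \<bullet> a \<partial>uniform_unit_ball) = 0" by simp
    have "(\<integral>z. (\<phi> z \<bullet> a) * (\<phi> z \<bullet> b) \<partial>uniform_unit_ball)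
        = (\<integral>z. (\<phi> (T z) \<bullet> a) * (\<phi> (T z) \<bullet> b) \<partial>uniform_unit_ball)"
      by (rule integral_uniform_unit_ball_invariant[OF _ _ Tl Tn, symmetric]) measurable
    also have "\<dots> = (\<integral>z. - ((\<phi> z \<bullet> a) * (\<phi> z \<bullet> b)) \<partial>uniform_unit_ball)" if "a \<noteq> b"
      using a b that by (simp add: \<phi> Tn Tc)
    finally have "a \<noteq> b \<Longrightarrow> (\<integral>z. (\<phi> z \<bullet> a) * (\<phi> z \<bullet> b) \<partial>uniform_unit_ball) = 0" by simp
    with 1 show ?thesis by blast
  qed
  then show "(\<integral>z. \<phi> z \<bullet> a \<partial>uniform_unit_ball) = 0" by blast
  have swap: "(\<integral>z. (\<phi> z \<bullet> d)\<^sup>2 \<partial>uniform_unit_ball) = (\<integral>z. (\<phi> z \<bullet> a)\<^sup>2 \<partial>uniform_unit_ball)"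
    if d: "d \<in> Basis" for d
  proof -
    let ?\<tau> = "Transposition.transpose a d"
    define T where "T z = (\<Sum>e\<in>Basis. (z \<bullet> ?\<tau> e) *\<^sub>R e)" for z :: 'a
    have \<tau>: "bij_betw ?\<tau> Basis Basis" using a d by simp
    have [measurable]: "T \<in> borel_measurable borel" unfolding T_def by measurable
    have Tl: "distr lborel borel T = lborel"
      using distr_lborel_permute_coordinates[OF \<tau>] unfolding T_def[abs_def] .
    have Tc: "T z \<bullet> e = z \<bullet> ?\<tau> e" if "e \<in> Basis" for z e
      using that by (simp add: T_def)
    have Tn: "norm (T z) = norm z" for z
      unfolding norm_eq euclidean_inner[of "T z" "T z"] euclidean_inner[of z z]
      using sum.reindex_bij_betw[OF \<tau>, of "\<lambda>e. (z \<bullet> e) * (z \<bullet> e)"] by (simp add: Tc)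
    have "(\<integral>z. (\<phi> z \<bullet> a)\<^sup>2 \<partial>uniform_unit_ball) = (\<integral>z. (\<phi> (T z) \<bullet> a)\<^sup>2 \<partial>uniform_unit_ball)"
      by (rule integral_uniform_unit_ball_invariant[OF _ _ Tl Tn, symmetric]) measurable
    then show ?thesis
      using a by (simp add: \<phi> Tn Tc)
  qed
  have "integrable uniform_unit_ball (\<lambda>z. (\<phi> z \<bullet> d)\<^sup>2)" if d: "d \<in> Basis" for d
  proof (rule integrable_const_bound[where B = 1])
    show "AE z in uniform_unit_ball. norm ((\<phi> z \<bullet> d)\<^sup>2) \<le> 1"
      using bound
    proof eventually_elim
      case (elim z)
      then have "\<bar>\<phi> z \<bullet> d\<bar> \<le> 1" using Basis_le_norm[OF d, of "\<phi> z"] by linarith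
      then show ?case by (simp add: abs_square_le_1)
    qed
  qed measurable
  then have "(\<Sum>d\<in>Basis. (\<integral>z. (\<phi> z \<bullet> d)\<^sup>2 \<partial>uniform_unit_ball)) = (\<integral>z. (\<Sum>d\<in>Basis. (\<phi> z \<bullet> d)\<^sup>2) \<partial>uniform_unit_ball)"
    by (rule Bochner_Integration.integral_sum[symmetric])
  moreover have "(\<Sum>d\<in>Basis. (\<phi> z \<bullet> d)\<^sup>2) = (norm (\<phi> z))\<^sup>2" for z
    unfolding power2_norm_eq_inner euclidean_inner[of "\<phi> z" "\<phi> z"] by (simp add: power2_eq_square)
  ultimately have "(\<integral>z. (norm (\<phi> z))\<^sup>2 \<partial>uniform_unit_ball) = (\<Sum>d\<in>Basis. (\<integral>z. (\<phi> z \<bullet> d)\<^sup>2 \<partial>uniform_unit_ball))"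
    by simp
  also have "\<dots> = DIM('a) * (\<integral>z. (\<phi> z \<bullet> a)\<^sup>2 \<partial>uniform_unit_ball)"
    by (simp add: swap)
  finally show "(\<integral>z. (\<phi> z \<bullet> a) * (\<phi> z \<bullet> b) \<partial>uniform_unit_ball) =
      (if a = b then (\<integral>z. (norm (\<phi> z))\<^sup>2 \<partial>uniform_unit_ball) / DIM('a) else 0)"
    using reflect by (simp add: power2_eq_square)
qed

lemma AE_uniform_unit_ball:
  "(AE z in uniform_unit_ball. P z) \<longleftrightarrow> (AE z in lborel. z \<in> ball (0::'a::euclidean_space) 1 \<longrightarrow> P z)"
  using measure_unit_ball_pos[where 'a='a]
  by (intro AE_uniform_measure) (simp_all add: emeasure_unit_ball)

text \<open>
  Write \<open>1 - |z|\<^sup>2\<close> as the integral of \<open>2 t\<close> over \<open>|z| < t \<le> 1\<close> and exchange the integrals: the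
  points with \<open>|z| < t\<close> fill a ball of volume \<open>V t^m\<close>, so the integral of \<open>1 - |z|\<^sup>2\<close> over the unit
  ball is that of \<open>2 V t^(m + 1)\<close> over \<open>[0, 1]\<close>, namely \<open>2 V / (m + 2)\<close>.
\<close>
lemma second_moment_uniform_unit_ball:
  "(\<integral>z. (norm z)\<^sup>2 \<partial>(uniform_unit_ball :: 'a::euclidean_space measure)) = real DIM('a) / (real DIM('a) + 2)"
proof -
  interpret prob_space "uniform_unit_ball :: 'a measure" by (rule prob_space_uniform_unit_ball)
  define V where "V = unit_ball_vol (DIM('a))"
  have V: "V > 0" by (simp add: V_def)
  have mV: "measure lborel (ball (0::'a) 1) = V" by (simp add: V_def content_ball)
  define g :: "'a \<Rightarrow> real \<Rightarrow> ennreal"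
    where "g z t = (if norm z < t \<and> t \<le> 1 then ennreal (2 * t) else 0)" for z t
  have "(\<integral>\<^sup>+z. ennreal (indicator (ball 0 1) z * (1 - (norm z)\<^sup>2)) \<partial>(lborel :: 'a measure)) = (\<integral>\<^sup>+z. \<integral>\<^sup>+t. g z t \<partial>lborel \<partial>(lborel :: 'a measure))"
  proof (rule nn_integral_cong)
    fix z :: 'a
    show "ennreal (indicator (ball 0 1) z * (1 - (norm z)\<^sup>2)) = (\<integral>\<^sup>+t. g z t \<partial>lborel)"
    proof (cases "norm z < 1")
      case True
      have "(\<integral>\<^sup>+t. g z t \<partial>lborel) = (\<integral>\<^sup>+t. ennreal (2 * t) * indicator {norm z..1} t \<partial>lborel)"
        by (rule nn_integral_cong_AE) (use AE_lborel_singleton[of "norm z"] in eventually_elim, auto simp: g_def)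
      also have "\<dots> = ennreal (1\<^sup>2 - (norm z)\<^sup>2)"
        using True order_trans[OF norm_ge_zero[of z]]
        by (intro nn_integral_FTC_Icc) (auto intro!: derivative_eq_intros)
      finally show ?thesis using True by simp
    next
      case False
      then have "g z = (\<lambda>t. 0)" by (auto simp: g_def)
      with False show ?thesis by simp
    qed
  qed
  also have "\<dots> = (\<integral>\<^sup>+t. \<integral>\<^sup>+z. g z t \<partial>(lborel :: 'a measure) \<partial>lborel)"
    unfolding g_def by (rule lborel_pair.Fubini'[symmetric]) measurable
  also have "\<dots> = (\<integral>\<^sup>+t. ennreal (2 * V * t ^ (DIM('a) + 1)) * indicator {0..1} t \<partial>lborel)"
  proof (rule nn_integral_cong)
    fix t :: real
    show "(\<integral>\<^sup>+z. g z t \<partial>(lborel :: 'a measure)) = ennreal (2 * V * t ^ (DIM('a) + 1)) * indicator {0..1} t"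
    proof (cases "0 \<le> t \<and> t \<le> 1")
      case True
      have "(\<integral>\<^sup>+z. g z t \<partial>(lborel :: 'a measure)) = (\<integral>\<^sup>+z. ennreal (2 * t) * indicator (ball 0 t) z \<partial>(lborel :: 'a measure))"
        using True by (intro nn_integral_cong) (auto simp: g_def)
      also have "\<dots> = ennreal (2 * t) * ennreal (V * t ^ DIM('a))"
        using True by (subst nn_integral_cmult_indicator) (auto simp: emeasure_ball V_def)
      also have "\<dots> = ennreal (2 * V * t ^ (DIM('a) + 1))"
        using True V by (subst ennreal_mult[symmetric]) (auto simp: algebra_simps)
      finally show ?thesis using True by simp
    next
      case False
      then have "g z t = 0" for z by (auto simp: g_def) (smt (verit) norm_ge_zero)
      with False show ?thesis by auto
    qed
  qed
  also have "\<dots> = ennreal (2 * V / (DIM('a) + 2) * 1 ^ (DIM('a) + 2) - 2 * V / (DIM('a) + 2) * 0 ^ (DIM('a) + 2))"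
  proof (rule nn_integral_FTC_Icc)
    fix t :: real
    show "((\<lambda>t. 2 * V / (DIM('a) + 2) * t ^ (DIM('a) + 2)) has_real_derivative
        2 * V * t ^ (DIM('a) + 1)) (at t)"
      by (rule DERIV_cong[OF DERIV_cmult[OF DERIV_pow]]) (simp add: field_simps)
  qed (use V in auto)
  finally have "(\<integral>z. indicator (ball 0 1) z * (1 - (norm z)\<^sup>2) \<partial>(lborel :: 'a measure)) = 2 * V / (DIM('a) + 2)"
    using V by (intro integral_eq_nn_integral[THEN trans])
      (auto simp: indicator_def power_le_one abs_square_le_1)
  then have 1: "expectation (\<lambda>z. 1 - (norm z)\<^sup>2) = 2 / (DIM('a) + 2)"
    using V by (subst integral_uniform_unit_ball) (auto simp: mV)
  have "integrable (uniform_unit_ball :: 'a measure) (\<lambda>z. (norm z)\<^sup>2)"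
    by (rule integrable_const_bound[where B = 1]) (auto simp: AE_uniform_unit_ball abs_square_le_1)
  then have "expectation (\<lambda>z. 1 - (norm z)\<^sup>2) = 1 - expectation (\<lambda>z. (norm z)\<^sup>2)"
    by (simp add: prob_space[simplified])
  with 1 show ?thesis by (simp add: field_simps)
qed

section \<open>The two means as expectations over the unit ball\<close>

lemma ball_mean_eq_expectation:
  fixes f :: "'a::euclidean_space \<Rightarrow> real"
  assumes [measurable]: "f \<in> borel_measurable borel" and r: "r > 0"
  shows "ball_mean f x r = (\<integral>z. f (x + r *\<^sub>R z) \<partial>uniform_unit_ball)"
proof -
  have [measurable]: "(\<lambda>y. indicator (ball x r) y * f y) \<in> borel_measurable borel" by measurable
  have "(LINT y:ball x r|lborel. f y) = r ^ DIM('a) *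
      (\<integral>z. indicator (ball x r) (x + r *\<^sub>R z) * f (x + r *\<^sub>R z) \<partial>lborel)"
    using r unfolding set_lebesgue_integral_def real_scaleR_def
    by (subst lborel_integral_affine[of "\<lambda>y. indicator (ball x r) y * f y" r x]) simp_all
  also have "(\<lambda>z::'a. indicator (ball x r) (x + r *\<^sub>R z) :: real) = indicator (ball 0 1)"
    using r by (auto simp: fun_eq_iff indicator_def dist_norm)
  finally show ?thesis
    using r by (simp add: ball_mean_def integral_uniform_unit_ball content_ball)
qed

text \<open>
  The surface measure is the image of \<open>m / r\<close> times Lebesgue measure on the punctured ball under
  the radial projection, and after rescaling the ball to the unit ball this projection is
  \<open>z \<mapsto> x + r sgn z\<close>. The constants cancel against the area \<open>m V r^(m - 1)\<close>.
\<close>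
lemma sphere_mean_eq_expectation:
  fixes f :: "'a::euclidean_space \<Rightarrow> real"
  assumes [measurable]: "f \<in> borel_measurable borel" and r: "r > 0"
  shows "sphere_mean f x r = (\<integral>z. f (x + r *\<^sub>R sgn z) \<partial>uniform_unit_ball)"
proof -
  let ?R = "restrict_space lborel (cball x r - {x})"
  let ?p = "\<lambda>z. x + (r / dist x z) *\<^sub>R (z - x)"
  have [measurable]: "?p \<in> borel_measurable borel" by measurable
  have [measurable]: "?p \<in> measurable ?R borel"
    by (intro measurable_restrict_space1) measurable
  have [measurable]: "(\<lambda>y. indicator (sphere x r) y * f y) \<in> borel_measurable borel" by measurable
  have "sphere_measure x r = density (distr ?R borel ?p) (\<lambda>_. ennreal (DIM('a) / r))"
    unfolding sphere_measure_def by (rule measure_eqI) (simp_all add: emeasure_density_const)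
  then have "(LINT y:sphere x r|sphere_measure x r. f y) =
      DIM('a) / r * (\<integral>z. indicator (sphere x r) (?p z) * f (?p z) \<partial>?R)"
    using r by (simp add: set_lebesgue_integral_def integral_density[of "\<lambda>y. indicator (sphere x r) y * f y"] integral_distr)
  also have "(\<integral>z. indicator (sphere x r) (?p z) * f (?p z) \<partial>?R) =
      (\<integral>z. indicator (cball x r - {x}) z * f (?p z) \<partial>lborel)"
    using r by (subst integral_restrict_space)
      (auto intro!: Bochner_Integration.integral_cong simp: indicator_def dist_norm norm_minus_commute)
  also have "\<dots> = r ^ DIM('a) *
      (\<integral>z. indicator (cball x r - {x}) (x + r *\<^sub>R z) * f (?p (x + r *\<^sub>R z)) \<partial>lborel)"
    using r by (subst lborel_integral_affine[of _ r x]) auto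
  also have "(\<integral>z. indicator (cball x r - {x}) (x + r *\<^sub>R z) * f (?p (x + r *\<^sub>R z)) \<partial>lborel) =
      (\<integral>z. indicator (ball 0 1) z * f (x + r *\<^sub>R sgn z) \<partial>lborel)"
  proof (rule integral_cong_AE)
    \<comment> \<open>The centre and the boundary sphere, where the two integrands differ, are null sets.\<close>
    have "AE z in lborel. (z::'a) \<notin> sphere 0 1"
      using negligible_sphere[of "0::'a" 1]
      by (intro AE_not_in) (auto simp: null_sets_completion_iff negligible_iff_null_sets)
    with AE_lborel_singleton[of "0::'a"]
    show "AE z in lborel. indicator (cball x r - {x}) (x + r *\<^sub>R z) * f (?p (x + r *\<^sub>R z)) =
        indicator (ball 0 1) z * f (x + r *\<^sub>R sgn z)"
      by eventually_elim (use r in \<open>auto simp: indicator_def dist_norm sgn_div_norm field_simps\<close>)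
  qed measurable
  finally show ?thesis
    using r by (simp add: sphere_mean_def measure_sphere integral_uniform_unit_ball content_ball
        power_diff field_simps)
qed

section \<open>Asymptotic mean value formulas\<close>

lemma radial_mean_tendsto:
  fixes u :: "'a::euclidean_space \<Rightarrow> real" and \<phi> :: "'a \<Rightarrow> 'a"
    and u' :: "'a \<Rightarrow> 'a \<Rightarrow>\<^sub>L real" and u2 :: "'a \<Rightarrow>\<^sub>L ('a \<Rightarrow>\<^sub>L real)"
  assumes u: "u \<in> borel_measurable borel"
    and \<phi>: "\<And>z. \<phi> z = w (norm z) *\<^sub>R z" "\<phi> \<in> borel_measurable borel"
    and bound: "AE z in uniform_unit_ball. norm (\<phi> z) \<le> 1"
    and D: "open D" "x \<in> D"
    and u': "\<And>y. y \<in> D \<Longrightarrow> (u has_derivative blinfun_apply (u' y)) (at y)"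
    and u2: "(u' has_derivative blinfun_apply u2) (at x)"
  shows "((\<lambda>r. ((\<integral>z. u (x + r *\<^sub>R \<phi> z) \<partial>uniform_unit_ball) - u x) / r\<^sup>2) \<longlongrightarrow>
    (\<integral>z. (norm (\<phi> z))\<^sup>2 \<partial>uniform_unit_ball) / (2 * DIM('a)) * laplacian u x) (at_right 0)"
proof -
  interpret prob_space "uniform_unit_ball :: 'a measure" by (rule prob_space_uniform_unit_ball)
  note moments = radial_moments_uniform_unit_ball[OF \<phi> bound]
  have "((\<lambda>r. (expectation (\<lambda>z. u (x + r *\<^sub>R \<phi> z)) - u x) / r\<^sup>2)
      \<longlongrightarrow> expectation (\<lambda>z. (norm (\<phi> z))\<^sup>2) / DIM('a) / 2 * (\<Sum>b\<in>Basis. u2 b b)) (at_right 0)"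
    by (rule expectation_random_displacement[OF u _ bound _ _ D u' u2])
      (use \<phi>(2) moments in simp_all)
  then show ?thesis
    by (simp add: laplacian_eq_trace[OF D u' u2] mult.commute)
qed

lemma ball_mean_cong:
  assumes "\<And>y. y \<in> ball x r \<Longrightarrow> f y = g y"
  shows "ball_mean f x r = ball_mean g x r"
  unfolding ball_mean_def set_lebesgue_integral_def
  by (intro arg_cong2[where f = "(/)"] Bochner_Integration.integral_cong) (auto simp: assms indicator_def)

lemma sphere_mean_cong:
  assumes "\<And>y. y \<in> sphere x r \<Longrightarrow> f y = g y"
  shows "sphere_mean f x r = sphere_mean g x r"
  unfolding sphere_mean_def set_lebesgue_integral_def
  by (intro arg_cong2[where f = "(/)"] Bochner_Integration.integral_cong) (auto simp: assms indicator_def)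

text \<open>
  The expansion for both means, with \<open>\<phi> z = z\<close> for the ball and \<open>\<phi> z = sgn z\<close> for the sphere.
\<close>
theorem mean_value_tendsto_laplacian:
  fixes u :: "'a::euclidean_space \<Rightarrow> real"
  assumes C2: "C2_on u D" and D: "open D" "x \<in> D"
  shows "((\<lambda>r. (ball_mean u x r - u x) / r\<^sup>2) \<longlongrightarrow> laplacian u x / (2 * (real DIM('a) + 2))) (at_right 0)"
    and "((\<lambda>r. (sphere_mean u x r - u x) / r\<^sup>2) \<longlongrightarrow> laplacian u x / (2 * real DIM('a))) (at_right 0)"
proof -
  interpret prob_space "uniform_unit_ball :: 'a measure" by (rule prob_space_uniform_unit_ball)
  obtain u' :: "'a \<Rightarrow> 'a \<Rightarrow>\<^sub>L real" and u'' :: "'a \<Rightarrow> 'a \<Rightarrow>\<^sub>L ('a \<Rightarrow>\<^sub>L real)"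
    where u': "\<And>y. y \<in> D \<Longrightarrow> (u has_derivative blinfun_apply (u' y)) (at y)"
      and u'': "\<And>y. y \<in> D \<Longrightarrow> (u' has_derivative blinfun_apply (u'' y)) (at y)"
    using C2 unfolding C2_on_def by blast
  \<comment> \<open>The values of \<open>u\<close> outside \<open>D\<close> are arbitrary. Replacing them by \<open>0\<close> makes the function Borel
    measurable and changes neither the means over small radii nor the derivatives in \<open>D\<close>.\<close>
  define v where "v y = indicator D y * u y" for y
  have v_eq: "v y = u y" if "y \<in> D" for y using that by (simp add: v_def)
  have "continuous_on D u"
    using u' by (meson has_derivative_continuous continuous_at_imp_continuous_on)
  then have v: "v \<in> borel_measurable borel"
    using borel_measurable_continuous_on_indicator[of D u] D by (simp add: v_def[abs_def])
  have v': "(v has_derivative blinfun_apply (u' y)) (at y)" if "y \<in> D" for y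
    using has_derivative_transform_within_open[OF u'[OF that] D(1) that] v_eq by simp
  have lap: "laplacian v x = laplacian u x"
    using laplacian_eq_trace[OF D u' u''[OF D(2)]] laplacian_eq_trace[OF D v' u''[OF D(2)]]
    by simp
  obtain d where d: "d > 0" "ball x d \<subseteq> D" using D open_contains_ball by blast
  have near: "\<forall>\<^sub>F r in at_right 0. 0 < r \<and> r < d"
    using d(1) unfolding eventually_at_right_field by blast
  have "((\<lambda>r. ((\<integral>z. v (x + r *\<^sub>R z) \<partial>uniform_unit_ball) - v x) / r\<^sup>2) \<longlongrightarrow>
      real DIM('a) / (real DIM('a) + 2) / (2 * real DIM('a)) * laplacian u x) (at_right 0)"
    using radial_mean_tendsto[OF v _ _ _ D v' u''[OF D(2)], of "\<lambda>z. z" "\<lambda>_. 1"]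
    by (simp add: AE_uniform_unit_ball lap second_moment_uniform_unit_ball)
  also have "real DIM('a) / (real DIM('a) + 2) / (2 * real DIM('a)) * laplacian u x = laplacian u x / (2 * (real DIM('a) + 2))"
    by simp
  finally show "((\<lambda>r. (ball_mean u x r - u x) / r\<^sup>2) \<longlongrightarrow> laplacian u x / (2 * (real DIM('a) + 2))) (at_right 0)"
  proof (rule Lim_transform_eventually)
    show "\<forall>\<^sub>F r in at_right 0. ((\<integral>z. v (x + r *\<^sub>R z) \<partial>uniform_unit_ball) - v x) / r\<^sup>2 =
        (ball_mean u x r - u x) / r\<^sup>2"
      using near
    proof eventually_elim
      case (elim r)
      then have "ball_mean u x r = ball_mean v x r"
        using d by (intro ball_mean_cong) (auto simp: v_eq subset_iff)
      then show ?case using elim D by (simp add: ball_mean_eq_expectation[OF v] v_eq)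
    qed
  qed
  have norm_sgn: "AE z in uniform_unit_ball. norm (sgn (z::'a)) = 1"
    using AE_lborel_singleton[of "0::'a"]
    unfolding AE_uniform_unit_ball by eventually_elim (simp add: norm_sgn)
  have "expectation (\<lambda>z::'a. (norm (sgn z))\<^sup>2) = expectation (\<lambda>z. 1)"
    by (rule integral_cong_AE) (use norm_sgn in \<open>auto simp: sgn_div_norm[abs_def]\<close>)
  then have "((\<lambda>r. ((\<integral>z. v (x + r *\<^sub>R sgn z) \<partial>uniform_unit_ball) - v x) / r\<^sup>2) \<longlongrightarrow>
      1 / (2 * real DIM('a)) * laplacian u x) (at_right 0)"
    using radial_mean_tendsto[OF v _ _ _ D v' u''[OF D(2)], of sgn inverse] eventually_mono[OF norm_sgn, of "\<lambda>z. norm (sgn z) \<le> 1"]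
    by (simp add: sgn_div_norm[abs_def] lap prob_space[simplified])
  then show "((\<lambda>r. (sphere_mean u x r - u x) / r\<^sup>2) \<longlongrightarrow> laplacian u x / (2 * real DIM('a))) (at_right 0)"
    unfolding times_divide_eq_left mult_1_left
  proof (rule Lim_transform_eventually)
    show "\<forall>\<^sub>F r in at_right 0. ((\<integral>z. v (x + r *\<^sub>R sgn z) \<partial>uniform_unit_ball) - v x) / r\<^sup>2 =
        (sphere_mean u x r - u x) / r\<^sup>2"
      using near
    proof eventually_elim
      case (elim r)
      then have "sphere_mean u x r = sphere_mean v x r"
        using d by (intro sphere_mean_cong) (auto simp: v_eq subset_iff)
      then show ?case using elim D by (simp add: sphere_mean_eq_expectation[OF v] v_eq)
    qed
  qed
qed

theorem theorem3p5:
  fixes u :: "real ^ 'n \<Rightarrow> real" and D :: "(real ^ 'n) set" and \<mu> :: real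
  assumes "CARD('n) \<ge> 2" and "\<mu> \<noteq> 0" and "domain D" and "C2_on u D"
  shows
    "((\<forall>x\<in>D. ((\<lambda>r. (ball_mean u x r - u x) / r\<^sup>2)
          \<longlongrightarrow> \<mu>\<^sup>2 * u x / (2 * (real CARD('n) + 2))) (at_right 0))
      \<longrightarrow> panharmonic_on \<mu> u D) \<and>
     ((\<forall>x\<in>D. ((\<lambda>r. (sphere_mean u x r - u x) / r\<^sup>2)
          \<longlongrightarrow> \<mu>\<^sup>2 * u x / (2 * real CARD('n))) (at_right 0))
      \<longrightarrow> panharmonic_on \<mu> u D)"
proof (intro conjI impI)
  have D: "open D" using assms(3) by (simp add: domain_def)
  note expansion = mean_value_tendsto_laplacian[OF assms(4) D]
  have nontrivial: "\<not> trivial_limit (at_right (0::real))" by simp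
  {
    assume lim: "\<forall>x\<in>D. ((\<lambda>r. (ball_mean u x r - u x) / r\<^sup>2)
          \<longlongrightarrow> \<mu>\<^sup>2 * u x / (2 * (real CARD('n) + 2))) (at_right 0)"
    have "laplacian u x = \<mu>\<^sup>2 * u x" if "x \<in> D" for x
      using tendsto_unique[OF nontrivial expansion(1)[OF that] bspec[OF lim that]]
      by simp
    with assms(4) show "panharmonic_on \<mu> u D" by (simp add: panharmonic_on_def)
  next
    assume lim: "\<forall>x\<in>D. ((\<lambda>r. (sphere_mean u x r - u x) / r\<^sup>2)
          \<longlongrightarrow> \<mu>\<^sup>2 * u x / (2 * real CARD('n))) (at_right 0)"
    have "laplacian u x = \<mu>\<^sup>2 * u x" if "x \<in> D" for x
      using tendsto_unique[OF nontrivial expansion(2)[OF that] bspec[OF lim that]]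
      by simp
    with assms(4) show "panharmonic_on \<mu> u D" by (simp add: panharmonic_on_def)
  }
qed

end
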